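(* For any infinite set $X$ and the group $G=S_X$ of all bijections of $X$, the coarse space $(X,\mathcal E_G)$ has infinite asymptotic dimension, i.e. $\operatorname{asdim}(X,\mathcal E_G)=\infty$.
   Context: An entourage on a set $X$ is a subset $E\subseteq X\times X$ such that $\Delta_X\subseteq E=E^{-1}$, where $\Delta_X=\{(x,x):x\in X\}$ and $E^{-1}=\{(y,x):(x,y)\in E\}$. For entourages $E,F$ on $X$, $E\circ F=\{(x,z):\exists y\ (x,y)\in E,\ (y,z)\in F\}$. For $x\in X$, the $E$-ball around $x$ is $E[x]=\{y\in X:(x,y)\in E\}$. A coarse structure on $X$ is a family $\mathcal E$ of entourages on $X$ such that (i) $E\circ F\in\mathcal E$ for all $E,F\in\mathcal E$; (ii) an entourage $F$ on $X$ belongs to $\mathcal E$ whenever $F\subseteq E$ for some $E\in\mathcal E$. A coarse space is a pair $(X,\mathcal E)$ of a set and a coarse structure on it. The coarse structure generated by a base $\mathcal B$ consists of all entourages contained in some $B\in\mathcal B$. For a subgroup $G$ of the group $S_X$ of all bijections of $X$, $\mathcal E_G$ denotes the coarse structure on $X$ generated by the base consisting of the entourages $\{(x,y)\in X\times X:y\in\{x\}\cup Fx\cup F^{-1}x\}$, where $F$ runs over the finite subsets of $G$ (here $Fx=\{gx:g\in F\}$ and $F^{-1}=\{g^{-1}:g\in F\}$). A cover $\mathcal U$ of a coarse space $(X,\mathcal E)$ is uniformly bounded if there is $E\in\mathcal E$ with $U\times U\subseteq E$ for every $U\in\mathcal U$. The asymptotic dimension $\operatorname{asdim}(X,\mathcal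 E)$ is the smallest non-negative integer $n$ such that for any $E\in\mathcal E$ there is a uniformly bounded cover $\mathcal U$ of $X$ such that for every $x\in X$ the family $\{U\in\mathcal U:E[x]\cap U\ne\emptyset\}$ has cardinality $\le n+1$; if no such $n$ exists, then $\operatorname{asdim}(X,\mathcal E)=\infty$ and $X$ is said to have infinite asymptotic dimension. *)

theory Defs
  imports "HOL-Algebra.Bij" "HOL-Library.Extended_Nat"
begin

definition entourage :: "'a set \<Rightarrow> ('a \<times> 'a) set \<Rightarrow> bool" where
  "entourage X E \<longleftrightarrow> E \<subseteq> X \<times> X \<and> Id_on X \<subseteq> E \<and> E\<inverse> = E"

(* A composition of two symmetric relations need not be symmetric, so closure under
   composition is read as: the composition is contained in a member of the family. *)
definition coarse_structure :: "'a set \<Rightarrow> ('a \<times> 'a) set set \<Rightarrow> bool" where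
  "coarse_structure X \<E> \<longleftrightarrow>
     (\<forall>E\<in>\<E>. entourage X E) \<and>
     (\<forall>E\<in>\<E>. \<forall>F\<in>\<E>. \<exists>D\<in>\<E>. E O F \<subseteq> D) \<and>
     (\<forall>E\<in>\<E>. \<forall>F. entourage X F \<and> F \<subseteq> E \<longrightarrow> F \<in> \<E>)"

definition generated_coarse_structure ::
    "'a set \<Rightarrow> ('a \<times> 'a) set set \<Rightarrow> ('a \<times> 'a) set set" where
  "generated_coarse_structure X \<B> = {E. entourage X E \<and> (\<exists>B\<in>\<B>. E \<subseteq> B)}"

definition orbit_entourage :: "'a set \<Rightarrow> ('a \<Rightarrow> 'a) set \<Rightarrow> ('a \<times> 'a) set" where
  "orbit_entourage X F =
     {(x, y) \<in> X \<times> X. y \<in> {x} \<union> (\<lambda>g. g x) ` F \<union> (\<lambda>g. (inv\<^bsub>BijGroup X\<^esub> g) x) ` F}"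

definition group_coarse_structure :: "'a set \<Rightarrow> ('a \<Rightarrow> 'a) set \<Rightarrow> ('a \<times> 'a) set set" where
  "group_coarse_structure X G =
     generated_coarse_structure X {orbit_entourage X F | F. finite F \<and> F \<subseteq> G}"

definition uniformly_bounded_cover ::
    "'a set \<Rightarrow> ('a \<times> 'a) set set \<Rightarrow> 'a set set \<Rightarrow> bool" where
  "uniformly_bounded_cover X \<E> \<U> \<longleftrightarrow> \<Union>\<U> = X \<and> (\<exists>E\<in>\<E>. \<forall>U\<in>\<U>. U \<times> U \<subseteq> E)"

(* The ball E[x] is the relational image E `` {x}. *)
definition asdim_at_most :: "'a set \<Rightarrow> ('a \<times> 'a) set set \<Rightarrow> nat \<Rightarrow> bool" where
  "asdim_at_most X \<E> n \<longleftrightarrow>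
     (\<forall>E\<in>\<E>. \<exists>\<U>. uniformly_bounded_cover X \<E> \<U> \<and>
        (\<forall>x\<in>X. finite {U \<in> \<U>. E `` {x} \<inter> U \<noteq> {}} \<and>
               card {U \<in> \<U>. E `` {x} \<inter> U \<noteq> {}} \<le> n + 1))"

definition asdim :: "'a set \<Rightarrow> ('a \<times> 'a) set set \<Rightarrow> enat" where
  "asdim X \<E> =
     (if \<exists>n. asdim_at_most X \<E> n then enat (LEAST n. asdim_at_most X \<E> n) else \<infinity>)"

lemma entourage_orbit_entourage:
  assumes G: "subgroup G (BijGroup X)" and F: "F \<subseteq> G"
  shows "entourage X (orbit_entourage X F)"
proof -
  interpret grp: group "BijGroup X" by (rule group_BijGroup)
  have sym: "(y, x) \<in> orbit_entourage X F" if xy: "(x, y) \<in> orbit_entourage X F" for x y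
  proof -
    have X: "x \<in> X" "y \<in> X" using xy by (auto simp: orbit_entourage_def)
    have c: "g \<in> Bij X" if "g \<in> F" for g
      using that F subgroup.subset[OF G] by (auto simp: BijGroup_def)
    have i: "(inv\<^bsub>BijGroup X\<^esub> g) (g x) = x" "g ((inv\<^bsub>BijGroup X\<^esub> g) x) = x" if "g \<in> F" for g
      using c[OF that] X
      by (auto simp: inv_BijGroup Bij_def bij_betw_def f_inv_into_f)
    consider "y = x" | g where "g \<in> F" "y = g x" | g where "g \<in> F" "y = (inv\<^bsub>BijGroup X\<^esub> g) x"
      using xy by (auto simp: orbit_entourage_def)
    then show ?thesis
    proof cases
      case 1
      then show ?thesis using X by (simp add: orbit_entourage_def)
    next
      case (2 g)
      then have "x = (inv\<^bsub>BijGroup X\<^esub> g) y" using i(1)[OF 2(1)] by simp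
      with 2(1) show ?thesis using X unfolding orbit_entourage_def by blast
    next
      case (3 g)
      then have "x = g y" using i(2)[OF 3(1)] by simp
      with 3(1) show ?thesis using X unfolding orbit_entourage_def by blast
    qed
  qed
  then have "(orbit_entourage X F)\<inverse> = orbit_entourage X F" by (auto intro: sym)
  then show ?thesis
    unfolding entourage_def by (auto simp: orbit_entourage_def)
qed

lemma orbit_entourage_comp:
  assumes G: "subgroup G (BijGroup X)" and F: "finite F" "F \<subseteq> G" and H: "finite H" "H \<subseteq> G"
  shows "\<exists>K. finite K \<and> K \<subseteq> G \<and> orbit_entourage X F O orbit_entourage X H \<subseteq> orbit_entourage X K"
proof -
  let ?S = "BijGroup X"
  interpret grp: group ?S by (rule group_BijGroup)
  define sy where "sy A = insert \<one>\<^bsub>?S\<^esub> (A \<union> (\<lambda>g. inv\<^bsub>?S\<^esub> g) ` A)" for A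
  have sy: "finite (sy A)" "sy A \<subseteq> G" if "finite A" "A \<subseteq> G" for A
    using that subgroup.one_closed[OF G] subgroup.m_inv_closed[OF G] by (auto simp: sy_def)
  have orb: "\<exists>g\<in>sy A. y = g x" if "(x, y) \<in> orbit_entourage X A" for x y A
    using that by (auto simp: sy_def orbit_entourage_def BijGroup_def)
  define K where "K = (\<lambda>(h, f). h \<otimes>\<^bsub>?S\<^esub> f) ` (sy H \<times> sy F)"
  have "finite K" "K \<subseteq> G"
    using sy[OF F] sy[OF H] subgroup.m_closed[OF G] by (auto simp: K_def)
  moreover have "(x, z) \<in> orbit_entourage X K"
    if xyz: "(x, y) \<in> orbit_entourage X F" "(y, z) \<in> orbit_entourage X H" for x y z
  proof -
    obtain f h where fh: "f \<in> sy F" "y = f x" "h \<in> sy H" "z = h y"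
      using orb[OF xyz(1)] orb[OF xyz(2)] by blast
    have "f \<in> Bij X" "h \<in> Bij X"
      using fh sy[OF F] sy[OF H] subgroup.subset[OF G] by (auto simp: BijGroup_def)
    moreover have X: "x \<in> X" "z \<in> X" using xyz by (auto simp: orbit_entourage_def)
    ultimately have "z = (h \<otimes>\<^bsub>?S\<^esub> f) x" using fh by (auto simp: BijGroup_def compose_def)
    moreover have "h \<otimes>\<^bsub>?S\<^esub> f \<in> K" using fh by (auto simp: K_def)
    ultimately show ?thesis using X by (auto simp: orbit_entourage_def)
  qed
  ultimately show ?thesis by (intro exI[of _ K]) auto
qed

lemma coarse_structure_group_coarse_structure:
  assumes G: "subgroup G (BijGroup X)"
  shows "coarse_structure X (group_coarse_structure X G)"
proof -
  have "\<exists>D\<in>group_coarse_structure X G. E O F \<subseteq> D"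
    if EF: "E \<in> group_coarse_structure X G" "F \<in> group_coarse_structure X G" for E F
  proof -
    obtain A B where A: "finite A" "A \<subseteq> G" "E \<subseteq> orbit_entourage X A"
      and B: "finite B" "B \<subseteq> G" "F \<subseteq> orbit_entourage X B"
      using EF unfolding group_coarse_structure_def generated_coarse_structure_def by blast
    obtain K where K: "finite K" "K \<subseteq> G"
        "orbit_entourage X A O orbit_entourage X B \<subseteq> orbit_entourage X K"
      using orbit_entourage_comp[OF G A(1,2) B(1,2)] by blast
    have "orbit_entourage X K \<in> group_coarse_structure X G"
      using entourage_orbit_entourage[OF G K(2)] K(1,2)
      unfolding group_coarse_structure_def generated_coarse_structure_def by blast
    moreover have "E O F \<subseteq> orbit_entourage X K" using A(3) B(3) K(3) by blast
    ultimately show ?thesis by blast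
  qed
  moreover have "\<forall>E\<in>group_coarse_structure X G. entourage X E"
    by (simp add: group_coarse_structure_def generated_coarse_structure_def)
  moreover have "\<forall>E\<in>group_coarse_structure X G. \<forall>F. entourage X F \<and> F \<subseteq> E \<longrightarrow>
      F \<in> group_coarse_structure X G"
    unfolding group_coarse_structure_def generated_coarse_structure_def
    by (blast intro: order_trans)
  ultimately show ?thesis unfolding coarse_structure_def by blast
qed

end

theory Submission
  imports Defs "HOL-Combinatorics.Permutations" Complex_Main
begin

text \<open>A uniformly bounded cover consists of sets of at most \<open>m\<close> points, so choosing a member of
  the cover through each point colours \<open>X\<close> with colour classes of size at most \<open>m\<close>. With
  \<open>k = n + 1\<close>, a counting argument produces, for each \<open>m\<close>, a number \<open>N\<close> and \<open>k + 2\<close> permutations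
  of \<open>N\<close> points such that every colouring of this kind has a point whose images under the
  permutations show more than \<open>k\<close> colours: a fixed colouring violates this for at most
  \<open>(N ^ k * (k * m) ^ (k + 2)) ^ N\<close> of the \<open>(fact N) ^ (k + 2)\<close> tuples of permutations, and there
  are at most \<open>N ^ N\<close> colourings. The number of permutations does not depend on \<open>m\<close>, so placing
  the finite configurations for all \<open>m\<close> on disjoint subsets of \<open>X\<close> gives \<open>k + 2\<close> bijections
  of \<open>X\<close> whose orbit entourage defeats every uniformly bounded cover at once.\<close>

section \<open>Counting colourings against tuples of permutations\<close>

text \<open>A single term of the exponential series is at most its sum. This serves as a lower bound
  for the number of permutations.\<close>

lemma power_self_le_fact_exp: "real N ^ N \<le> fact N * exp (real N)"
proof -
  have "(\<Sum>i\<in>{N}. real N ^ i /\<^sub>R fact i) \<le> (\<Sum>i. real N ^ i /\<^sub>R fact i)"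
    by (rule sum_le_suminf[OF summable_exp_generic]) auto
  then have "real N ^ N / fact N \<le> exp (real N)"
    by (simp add: exp_def field_simps)
  then show ?thesis by (simp add: field_simps)
qed

text \<open>The image of \<open>w\<close> meets at most \<open>k\<close> colour classes; fixing a representative \<open>r a\<close> of each
  leaves at most \<open>k * m\<close> possible values for every \<open>w i\<close>.\<close>

lemma card_PiE_image_le:
  assumes V: "finite V" and fib: "\<And>v. v \<in> V \<Longrightarrow> card {y \<in> V. f y = f v} \<le> m"
    and k: "0 < k" and I: "finite I" "I \<noteq> {}"
  shows "card {w \<in> I \<rightarrow>\<^sub>E V. card (f ` w ` I) \<le> k} \<le> card V ^ k * (k * m) ^ card I"
proof -
  let ?S = "\<lambda>r. {y \<in> V. f y \<in> f ` r ` {..<k}}"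
  let ?R = "{..<k} \<rightarrow>\<^sub>E V"
  have S: "card (?S r) \<le> k * m" if r: "r \<in> ?R" for r
  proof -
    have "?S r = (\<Union>a<k. {y \<in> V. f y = f (r a)})" by auto
    then have "card (?S r) \<le> (\<Sum>a<k. card {y \<in> V. f y = f (r a)})"
      by (simp add: card_UN_le)
    also have "\<dots> \<le> (\<Sum>a<k. m)" using r by (intro sum_mono fib) auto
    finally show ?thesis by simp
  qed
  have "{w \<in> I \<rightarrow>\<^sub>E V. card (f ` w ` I) \<le> k} \<subseteq> (\<Union>r\<in>?R. I \<rightarrow>\<^sub>E ?S r)"
  proof
    fix w assume "w \<in> {w \<in> I \<rightarrow>\<^sub>E V. card (f ` w ` I) \<le> k}"
    then have w: "w \<in> I \<rightarrow>\<^sub>E V" "card (f ` w ` I) \<le> k" by auto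
    let ?A = "f ` w ` I"
    have fin: "finite ?A" "?A \<noteq> {}" using I by auto
    then obtain e where e: "bij_betw e {..<card ?A} ?A"
      using ex_bij_betw_nat_finite[of ?A] by (auto simp: atLeast0LessThan)
    have A: "?A \<subseteq> f ` V" using w by auto
    have card: "0 < card ?A" using fin by (simp add: card_gt_0_iff)
    \<comment> \<open>\<open>r\<close> needs \<open>k\<close> values even when fewer colours occur.
      Surplus indices repeat the colour \<open>e 0\<close>, which exists because \<open>I\<close> is
      nonempty.\<close>
    define r where "r = (\<lambda>a\<in>{..<k}. inv_into V f (e (if a < card ?A then a else 0)))"
    have eA: "e (if a < card ?A then a else 0) \<in> ?A" for a
      using bij_betwE[OF e] card by auto
    have "r \<in> ?R" unfolding r_def using eA A by (auto intro!: inv_into_into)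
    moreover have "?A \<subseteq> f ` r ` {..<k}"
    proof
      fix b assume "b \<in> ?A"
      moreover obtain a where a: "a < card ?A" "b = e a"
        using e \<open>b \<in> ?A\<close> unfolding bij_betw_def by blast
      ultimately have "f (r a) = b"
        using w(2) A f_inv_into_f[of b f V] by (auto simp: r_def)
      then show "b \<in> f ` r ` {..<k}" using a w(2) by (metis image_eqI less_le_trans lessThan_iff)
    qed
    moreover from this have "w \<in> I \<rightarrow>\<^sub>E ?S r" using w(1) by (auto simp: PiE_iff)
    ultimately show "w \<in> (\<Union>r\<in>?R. I \<rightarrow>\<^sub>E ?S r)" by blast
  qed
  then have "card {w \<in> I \<rightarrow>\<^sub>E V. card (f ` w ` I) \<le> k} \<le> card (\<Union>r\<in>?R. I \<rightarrow>\<^sub>E ?S r)"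
    using V I by (intro card_mono finite_UN_I finite_PiE) auto
  also have "\<dots> \<le> (\<Sum>r\<in>?R. card (I \<rightarrow>\<^sub>E ?S r))"
    using V by (intro card_UN_le finite_PiE) auto
  also have "\<dots> \<le> (\<Sum>r\<in>?R. (k * m) ^ card I)"
    using I S by (intro sum_mono) (auto simp: card_PiE intro!: power_mono)
  also have "\<dots> = card V ^ k * (k * m) ^ card I" by (simp add: card_PiE)
  finally show ?thesis .
qed

text \<open>A tuple of permutations is encoded by the map sending a point to the tuple of its images;
  if the points only ever see few colours, each of these image tuples is one of the few counted in
  the previous lemma.\<close>

lemma card_permutation_tuples_few_colours:
  assumes V: "finite V" and fib: "\<And>v. v \<in> V \<Longrightarrow> card {y \<in> V. f y = f v} \<le> m"
    and k: "0 < k" and I: "finite I" "I \<noteq> {}"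
  shows "card {p \<in> I \<rightarrow>\<^sub>E {q. q permutes V}. \<forall>x\<in>V. card (f ` (\<lambda>i. p i x) ` I) \<le> k}
    \<le> (card V ^ k * (k * m) ^ card I) ^ card V"
proof -
  let ?P = "{p \<in> I \<rightarrow>\<^sub>E {q. q permutes V}. \<forall>x\<in>V. card (f ` (\<lambda>i. p i x) ` I) \<le> k}"
  let ?B = "{w \<in> I \<rightarrow>\<^sub>E V. card (f ` w ` I) \<le> k}"
  let ?t = "\<lambda>p. \<lambda>x\<in>V. \<lambda>i\<in>I. p i x"
  have "inj_on ?t ?P"
  proof (rule inj_onI)
    fix p q assume p: "p \<in> ?P" and q: "q \<in> ?P" and eq: "?t p = ?t q"
    have "p i x = q i x" if "i \<in> I" for i x
    proof (cases "x \<in> V")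
      case True
      then show ?thesis using fun_cong[OF fun_cong[OF eq, of x], of i] that by simp
    next
      case False
      moreover have "p i permutes V" "q i permutes V" using p q that by auto
      ultimately show ?thesis by (simp add: permutes_not_in)
    qed
    then show "p = q" using p q by (intro PiE_ext[of p I _ q]) auto
  qed
  moreover have "?t ` ?P \<subseteq> V \<rightarrow>\<^sub>E ?B"
  proof (intro image_subsetI PiE_I)
    fix p x assume p: "p \<in> ?P" and x: "x \<in> V"
    have "p i x \<in> V" if "i \<in> I" for i
      using p that x permutes_in_image[of "p i" V x] by (auto simp: PiE_iff)
    moreover have "f ` (\<lambda>i\<in>I. p i x) ` I = f ` (\<lambda>i. p i x) ` I" by auto
    ultimately show "?t p x \<in> ?B" using p x by auto
  qed simp
  ultimately have "card ?P \<le> card (V \<rightarrow>\<^sub>E ?B)"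
    using V I by (intro card_inj_on_le[of ?t]) (auto intro!: finite_PiE)
  also have "\<dots> = card ?B ^ card V" using V by (simp add: card_PiE)
  also have "\<dots> \<le> (card V ^ k * (k * m) ^ card I) ^ card V"
    using card_PiE_image_le[OF assms] by (intro power_mono) auto
  finally show ?thesis .
qed

lemma card_less_imp_ex_notin:
  assumes "card A < card B" "finite A"
  obtains b where "b \<in> B" "b \<notin> A"
  using assms card_mono[of A B] by fastforce

text \<open>Colourings and choices of representatives together cost \<open>k + 1\<close> factors
  \<open>N ^ N\<close>, whereas \<open>fact N ^ (k + 2)\<close> supplies \<open>k + 2\<close> of
  them up to a factor exponential in \<open>N\<close>. The spare \<open>N ^ N\<close> absorbs all
  exponential factors, whatever \<open>m\<close> is.\<close>

lemma ex_colour_spreading_permutations: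
  fixes k m :: nat
  assumes k: "0 < k"
  shows "\<exists>N p. (\<forall>i<k + 2. p i permutes {..<N}) \<and>
    (\<forall>f :: nat \<Rightarrow> nat. f ` {..<N} \<subseteq> {..<N} \<longrightarrow> (\<forall>v<N. card {y \<in> {..<N}. f y = f v} \<le> m) \<longrightarrow>
      (\<exists>x<N. k < card (f ` (\<lambda>i. p i x) ` {..<k + 2})))"
proof -
  let ?I = "{..<k + 2}"
  define C where "C = real ((k * m) ^ (k + 2))"
  \<comment> \<open>The left side is the base of the \<open>N\<close>-th power that the spare
    \<open>N ^ N\<close> has to beat.\<close>
  obtain N :: nat where N: "C * exp (real (k + 2)) < N" using reals_Archimedean2 by blast
  moreover have "0 \<le> C" by (simp add: C_def)
  ultimately have Npos: "0 < real N" by (smt (verit) exp_gt_zero mult_nonneg_nonneg)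
  let ?V = "{..<N}"
  let ?P = "?I \<rightarrow>\<^sub>E {q. q permutes ?V}"
  \<comment> \<open>\<open>N\<close> points show at most \<open>N\<close> colours, so self-maps of
    \<open>?V\<close> suffice; extensionality makes them finitely many.\<close>
  let ?F = "{f \<in> ?V \<rightarrow>\<^sub>E ?V. \<forall>v\<in>?V. card {y \<in> ?V. f y = f v} \<le> m}"
  let ?Bad = "\<lambda>f. {p \<in> ?P. \<forall>x\<in>?V. card (f ` (\<lambda>i. p i x) ` ?I) \<le> k}"
  have finP: "finite ?P" by (intro finite_PiE) (auto simp: finite_permutations)
  have finF: "finite ?F" by (rule finite_subset[of _ "?V \<rightarrow>\<^sub>E ?V"]) (auto intro: finite_PiE)
  have "card (\<Union>f\<in>?F. ?Bad f) \<le> (\<Sum>f\<in>?F. card (?Bad f))"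
    using finF by (rule card_UN_le)
  also have "\<dots> \<le> (\<Sum>f\<in>?F. (N ^ k * (k * m) ^ (k + 2)) ^ N)"
    using card_permutation_tuples_few_colours[of ?V _ m k ?I] k by (intro sum_mono) (force)
  also have "\<dots> \<le> card (?V \<rightarrow>\<^sub>E ?V) * (N ^ k * (k * m) ^ (k + 2)) ^ N"
    unfolding sum_constant of_nat_id by (intro mult_right_mono card_mono) (auto intro: finite_PiE)
  also have "\<dots> = N ^ N * (N ^ k * (k * m) ^ (k + 2)) ^ N" by (simp add: card_PiE)
  finally have "real (card (\<Union>f\<in>?F. ?Bad f)) \<le> real (N ^ N * (N ^ k * (k * m) ^ (k + 2)) ^ N)"
    by (simp only: of_nat_le_iff)
  then have bad: "real (card (\<Union>f\<in>?F. ?Bad f)) \<le> real N ^ N * (real N ^ k * C) ^ N"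
    unfolding C_def of_nat_mult of_nat_power .
  have cardP: "card ?P = fact N ^ (k + 2)"
    using card_permutations[of ?V N] by (simp add: card_PiE)
  have exp_swap: "exp (real N) ^ (k + 2) = exp (real (k + 2)) ^ N"
    by (simp only: exp_of_nat_mult[symmetric] mult.commute)
  \<comment> \<open>Scaling by the exponential lets the lower bound for \<open>fact N\<close> be
    applied without division; the factor cancels at the end.\<close>
  have "real N ^ N * (real N ^ k * C) ^ N * exp (real N) ^ (k + 2)
      = (real N ^ (k + 1)) ^ N * (C * exp (real (k + 2))) ^ N"
    unfolding exp_swap by (simp add: power_mult_distrib)
  also have "\<dots> < (real N ^ (k + 1)) ^ N * real N ^ N"
    using N Npos \<open>0 \<le> C\<close> by (intro mult_strict_left_mono power_strict_mono) auto
  also have "\<dots> = (real N ^ N) ^ (k + 2)"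
    by (simp add: power_mult[symmetric] power_add[symmetric] algebra_simps)
  also have "\<dots> \<le> (fact N * exp (real N)) ^ (k + 2)"
    by (intro power_mono power_self_le_fact_exp) auto
  also have "\<dots> = real (card ?P) * exp (real N) ^ (k + 2)"
    unfolding cardP by (simp only: power_mult_distrib of_nat_power of_nat_fact)
  finally have "real N ^ N * (real N ^ k * C) ^ N < real (card ?P)" by simp
  with bad have "card (\<Union>f\<in>?F. ?Bad f) < card ?P" by linarith
  moreover have "finite (\<Union>f\<in>?F. ?Bad f)"
    using finF finP by (intro finite_UN_I) auto
  ultimately obtain p where p: "p \<in> ?P" and notin: "p \<notin> (\<Union>f\<in>?F. ?Bad f)"
    by (elim card_less_imp_ex_notin)
  have "\<exists>x<N. k < card (f ` (\<lambda>i. p i x) ` ?I)"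
    if f: "f ` ?V \<subseteq> ?V" "\<forall>v<N. card {y \<in> ?V. f y = f v} \<le> m" for f
  proof -
    have "card {y \<in> ?V. restrict f ?V y = restrict f ?V v} \<le> m" if "v < N" for v
    proof -
      have "{y \<in> ?V. restrict f ?V y = restrict f ?V v} = {y \<in> ?V. f y = f v}" using that by auto
      then show ?thesis using f(2) that by simp
    qed
    then have "restrict f ?V \<in> ?F" using f(1) by auto
    with notin have "p \<notin> ?Bad (restrict f ?V)" by (rule contrapos_nn[OF _ UN_I])
    with p obtain x where x: "x < N" "k < card (restrict f ?V ` (\<lambda>i. p i x) ` ?I)"
      by (force simp: not_le)
    have "p i x \<in> ?V" if "i \<in> ?I" for i
      using p that x(1) permutes_in_image[of "p i" ?V x] by auto
    then have "restrict f ?V ` (\<lambda>i. p i x) ` ?I = f ` (\<lambda>i. p i x) ` ?I"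
      by (intro image_cong) auto
    then show ?thesis using x by auto
  qed
  moreover have "\<forall>i<k + 2. p i permutes ?V" using p by auto
  ultimately show ?thesis by blast
qed

text \<open>Only the partition into colour classes matters: naming each class by one of its points
  turns any colouring into a self-map of \<open>{..<N}\<close>. The colours will later be members of
  a cover.\<close>

lemma ex_partition_spreading_permutations:
  fixes k m :: nat
  assumes k: "0 < k"
  shows "\<exists>N p. (\<forall>i<k + 2. p i permutes {..<N}) \<and>
    (\<forall>f :: nat \<Rightarrow> 'b. (\<forall>v<N. card {y \<in> {..<N}. f y = f v} \<le> m) \<longrightarrow>
      (\<exists>x<N. k < card (f ` (\<lambda>i. p i x) ` {..<k + 2})))"
proof -
  obtain N p where p: "\<And>i. i < k + 2 \<Longrightarrow> p i permutes {..<N}"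
    and spread: "\<And>f :: nat \<Rightarrow> nat. f ` {..<N} \<subseteq> {..<N} \<Longrightarrow>
      (\<And>v. v < N \<Longrightarrow> card {y \<in> {..<N}. f y = f v} \<le> m) \<Longrightarrow>
      \<exists>x<N. k < card (f ` (\<lambda>i. p i x) ` {..<k + 2})"
    using ex_colour_spreading_permutations[OF k, of m] by blast
  have "\<exists>x<N. k < card (f ` (\<lambda>i. p i x) ` {..<k + 2})"
    if f: "\<And>v. v < N \<Longrightarrow> card {y \<in> {..<N}. f y = f v} \<le> m" for f :: "nat \<Rightarrow> 'b"
  proof -
    let ?c = "inv_into {..<N} f"
    have inv: "?c (f v) \<in> {..<N}" "f (?c (f v)) = f v" if "v < N" for v
      using that inv_into_into[of "f v" f "{..<N}"] by (auto intro: f_inv_into_f)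
    have "{y \<in> {..<N}. ?c (f y) = ?c (f v)} = {y \<in> {..<N}. f y = f v}" if "v < N" for v
      using inv that by (auto, metis inv(2))
    then obtain x where x: "x < N" "k < card ((\<lambda>y. ?c (f y)) ` (\<lambda>i. p i x) ` {..<k + 2})"
      using spread[of "\<lambda>y. ?c (f y)"] f inv(1) by force
    have "(\<lambda>y. ?c (f y)) ` (\<lambda>i. p i x) ` {..<k + 2} = ?c ` f ` (\<lambda>i. p i x) ` {..<k + 2}"
      by (simp add: image_image)
    then show ?thesis using x card_image_le[of "f ` (\<lambda>i. p i x) ` {..<k + 2}" ?c] by force
  qed
  then show ?thesis using p by blast
qed

section \<open>Transfer to bijections of an infinite set\<close>

lemma Bij_extend:
  assumes h: "inj h" "range h \<subseteq> X" and \<phi>: "bij \<phi>"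
  shows "\<exists>g\<in>Bij X. \<forall>z. g (h z) = h (\<phi> z)"
proof -
  \<comment> \<open>Off the range of \<open>h\<close> the map is the identity on \<open>X\<close>;
    the restriction to \<open>X\<close> is there because elements of \<open>Bij X\<close> are
    extensional.\<close>
  define g where "g = (\<lambda>x\<in>X. if x \<in> range h then h (\<phi> (inv_into UNIV h x)) else x)"
  have gh: "g (h z) = h (\<phi> z)" for z using h by (auto simp: g_def)
  have "bij_betw g (range h) (range h)"
  proof (rule bij_betw_imageI)
    show "inj_on g (range h)"
      using h(1) bij_is_inj[OF \<phi>] by (auto simp: inj_on_def gh dest: injD)
    show "g ` range h = range h"
      using bij_is_surj[OF \<phi>] by (simp add: image_image gh) (metis image_image)
  qed
  moreover have "bij_betw g (X - range h) (X - range h)"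
    by (rule bij_betw_cong[THEN iffD1, OF _ bij_betw_id]) (auto simp: g_def)
  ultimately have "bij_betw g (range h \<union> (X - range h)) (range h \<union> (X - range h))"
    by (rule bij_betw_combine) auto
  moreover have "range h \<union> (X - range h) = X" using h(2) by auto
  ultimately have "g \<in> Bij X" by (auto simp: Bij_def g_def)
  then show ?thesis using gh by blast
qed

text \<open>Each of the finitely many group elements and inverses behind \<open>E\<close> adds at
  most one point to a ball. The bound will limit the colour classes coming from a cover.\<close>

lemma group_coarse_structure_ball_card:
  assumes "E \<in> group_coarse_structure X G"
  shows "\<exists>m. \<forall>x. finite (E `` {x}) \<and> card (E `` {x}) \<le> m"
proof -
  obtain F where F: "finite F" "E \<subseteq> orbit_entourage X F"
    using assms unfolding group_coarse_structure_def generated_coarse_structure_def by blast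
  have "finite (E `` {x}) \<and> card (E `` {x}) \<le> 1 + card F + card F" for x
  proof -
    let ?B = "{x} \<union> (\<lambda>g. g x) ` F \<union> (\<lambda>g. (inv\<^bsub>BijGroup X\<^esub> g) x) ` F"
    have sub: "E `` {x} \<subseteq> ?B" using F(2) by (auto simp: orbit_entourage_def)
    have fin: "finite ?B" using F(1) by simp
    have "card ?B \<le> card {x} + card ((\<lambda>g. g x) ` F) + card ((\<lambda>g. (inv\<^bsub>BijGroup X\<^esub> g) x) ` F)"
      by (meson add_le_mono card_Un_le le_refl le_trans)
    also have "\<dots> \<le> 1 + card F + card F"
      using F(1) by (intro add_mono card_image_le) auto
    finally show ?thesis using card_mono[OF fin sub] finite_subset[OF sub fin] by linarith
  qed
  then show ?thesis by blast
qed

lemma not_asdim_at_most_Bij: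
  fixes X :: "'a set"
  assumes "infinite X"
  shows "\<not> asdim_at_most X (group_coarse_structure X (carrier (BijGroup X))) n"
proof
  let ?\<E> = "group_coarse_structure X (carrier (BijGroup X))"
  \<comment> \<open>The multiplicity to be exceeded is \<open>n + 1\<close>, so
    \<open>k = n + 1\<close> and \<open>k + 2\<close> permutations are used.\<close>
  let ?I = "{..<(n + 1) + 2}"
  assume asdim: "asdim_at_most X ?\<E> n"
  define spreads where "spreads m N p \<longleftrightarrow> (\<forall>i<(n + 1) + 2. p i permutes {..<N}) \<and>
    (\<forall>f :: nat \<Rightarrow> 'a set. (\<forall>v<N. card {y \<in> {..<N}. f y = f v} \<le> m) \<longrightarrow>
      (\<exists>x<N. n + 1 < card (f ` (\<lambda>i. p i x) ` ?I)))" for m N p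
  have "\<exists>N p. spreads m N p" for m
    unfolding spreads_def by (rule ex_partition_spreading_permutations) simp
  then obtain N p where "\<And>m. spreads m (N m) (p m)" by metis
  then have p: "\<And>m i. i \<in> ?I \<Longrightarrow> p m i permutes {..<N m}"
    and spread: "\<And>m (f :: nat \<Rightarrow> 'a set).
      (\<And>v. v < N m \<Longrightarrow> card {y \<in> {..<N m}. f y = f v} \<le> m) \<Longrightarrow>
      \<exists>x<N m. n + 1 < card (f ` (\<lambda>i. p m i x) ` ?I)"
    unfolding spreads_def by blast+
  obtain e :: "nat \<Rightarrow> 'a" where e: "inj e" "range e \<subseteq> X"
    using infinite_countable_subset[OF assms] by blast
  \<comment> \<open>\<open>h\<close> arranges a countable part of \<open>X\<close> in disjoint rows.
    In row \<open>m\<close> the first \<open>N m\<close> points are moved by \<open>p m i\<close>,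
    which fixes the rest of the row.\<close>
  define h where "h = e \<circ> prod_encode"
  have h: "inj h" "range h \<subseteq> X"
    using e by (auto simp: h_def intro!: inj_compose inj_prod_encode)
  have "bij (\<lambda>(m, j). (m, p m i j))" if "i \<in> ?I" for i
  proof (rule o_bij)
    show "(\<lambda>(m, j). (m, inv_into UNIV (p m i) j)) \<circ> (\<lambda>(m, j). (m, p m i j)) = id"
      using permutes_inverses(2)[OF p[OF that]] by auto
    show "(\<lambda>(m, j). (m, p m i j)) \<circ> (\<lambda>(m, j). (m, inv_into UNIV (p m i) j)) = id"
      using permutes_inverses(1)[OF p[OF that]] by auto
  qed
  then have "\<forall>i\<in>?I. \<exists>g\<in>Bij X. \<forall>z. g (h z) = h ((\<lambda>(m, j). (m, p m i j)) z)"
    using Bij_extend[OF h] by blast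
  then have "\<exists>g. \<forall>i\<in>?I. g i \<in> Bij X \<and> (\<forall>z. g i (h z) = h ((\<lambda>(m, j). (m, p m i j)) z))"
    unfolding Bex_def by (rule bchoice)
  then obtain g where g: "\<And>i. i \<in> ?I \<Longrightarrow> g i \<in> Bij X"
    and gh: "\<And>i m j. i \<in> ?I \<Longrightarrow> g i (h (m, j)) = h (m, p m i j)"
    by (auto simp del: lessThan_iff)
  let ?E = "orbit_entourage X (g ` ?I)"
  have F: "finite (g ` ?I)" "g ` ?I \<subseteq> carrier (BijGroup X)"
    using g by (auto simp: BijGroup_def)
  have "?E \<in> ?\<E>"
    using entourage_orbit_entourage[OF group.subgroup_self[OF group_BijGroup] F(2)] F
    unfolding group_coarse_structure_def generated_coarse_structure_def by blast
  with asdim obtain \<U> where \<U>: "uniformly_bounded_cover X ?\<E> \<U>"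
    and mult: "\<And>x. x \<in> X \<Longrightarrow> finite {U \<in> \<U>. ?E `` {x} \<inter> U \<noteq> {}}"
      "\<And>x. x \<in> X \<Longrightarrow> card {U \<in> \<U>. ?E `` {x} \<inter> U \<noteq> {}} \<le> n + 1"
    unfolding asdim_at_most_def by blast
  from \<U> obtain D where cover: "\<Union>\<U> = X" and D: "D \<in> ?\<E>" "\<And>U. U \<in> \<U> \<Longrightarrow> U \<times> U \<subseteq> D"
    unfolding uniformly_bounded_cover_def by blast
  \<comment> \<open>Only now does the cover single out a row \<open>m\<close>; \<open>?E\<close> was
    built beforehand and handles all rows.\<close>
  from group_coarse_structure_ball_card[OF D(1)] obtain m
    where m: "\<And>x. finite (D `` {x})" "\<And>x. card (D `` {x}) \<le> m" by blast
  have hX: "h z \<in> X" for z using h(2) by auto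
  then have "\<forall>j. \<exists>U\<in>\<U>. h (m, j) \<in> U" using cover by blast
  then obtain f where f: "\<And>j. f j \<in> \<U>" "\<And>j. h (m, j) \<in> f j" by metis
  have "card {y \<in> {..<N m}. f y = f v} \<le> m" for v
  proof -
    \<comment> \<open>Points of one colour share a member of the cover, hence lie in a common
      \<open>D\<close>-ball.\<close>
    have "(\<lambda>j. h (m, j)) ` {y \<in> {..<N m}. f y = f v} \<subseteq> D `` {h (m, v)}"
      using f D(2)[OF f(1)] by fastforce
    moreover have "inj_on (\<lambda>j. h (m, j)) {y \<in> {..<N m}. f y = f v}"
      using h(1) by (auto simp: inj_on_def)
    ultimately have "card {y \<in> {..<N m}. f y = f v} \<le> card (D `` {h (m, v)})"
      using m(1) by (intro card_inj_on_le)
    then show ?thesis using m(2) le_trans by blast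
  qed
  then obtain x where x: "n + 1 < card (f ` (\<lambda>i. p m i x) ` ?I)" using spread by blast
  have "h (m, p m i x) \<in> ?E `` {h (m, x)}" if "i \<in> ?I" for i
  proof -
    have "h (m, p m i x) \<in> (\<lambda>g. g (h (m, x))) ` g ` ?I"
      using gh[OF that, of m x] that by (metis image_eqI)
    then show ?thesis
      using hX[of "(m, x)"] hX[of "(m, p m i x)"] unfolding orbit_entourage_def by blast
  qed
  \<comment> \<open>Each colour seen from \<open>x\<close> is a member of the cover meeting the
    \<open>?E\<close>-ball around \<open>h (m, x)\<close>, so there are too many such
    members.\<close>
  then have "f ` (\<lambda>i. p m i x) ` ?I \<subseteq> {U \<in> \<U>. ?E `` {h (m, x)} \<inter> U \<noteq> {}}"
    using f by blast
  from card_mono[OF mult(1)[OF hX] this] mult(2)[OF hX, of "(m, x)"] x show False by linarith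
qed

theorem corollary1:
  fixes X :: "'a set"
  assumes "infinite X"
  shows "asdim X (group_coarse_structure X (carrier (BijGroup X))) = \<infinity>"
  using not_asdim_at_most_Bij[OF assms] by (simp add: asdim_def)

end
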